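(* Let $d>0$ and let $g:\mathbb{R}\to\mathbb{R}$ be an even, $d$-periodic function that is square-integrable over a period, with Fourier coefficients $\hat g_n=\frac{2}{d}\int_0^{d/2}g(x)\cos\left(\frac{2\pi n x}{d}\right)dx$, $n\in\mathbb{Z}$. For $\epsilon>0$, $\zeta\ge 0$ and $\xi\in[0,1]$ define (as $L^2$-convergent Fourier series in $\xi$) $$U_\epsilon(\xi,\zeta)=\sum_{n\in\mathbb{Z}}\hat g_n\,e^{2\pi i\xi n}\times\begin{cases}\exp\left(-\frac{2\pi i\zeta}{\epsilon^2}\sqrt{1-(n\epsilon)^2}\right), & |n|\le 1/\epsilon,\\ \exp\left(-\frac{2\pi\zeta}{\epsilon^2}\sqrt{(n\epsilon)^2-1}\right), & |n|>1/\epsilon,\end{cases}$$ and $$U_{\mathrm{Par}}(\xi,\zeta)=e^{-2\pi i\zeta/\epsilon^2}\sum_{n\in\mathbb{Z}}\hat g_n\,e^{2\pi i\xi n+i\pi\zeta n^2}.$$ Then for every $\zeta\ge 0$, $$\lim_{\epsilon\to 0^+}\int_0^1\left|U_\epsilon(\xi,\zeta)-U_{\mathrm{Par}}(\xi,\zeta)\right|^2\,d\xi=0.$$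
   Context: Here $g$ is the profile of a diffraction grating of period $d$, $\lambda$ is the wavelength of the light, $\omega=2\pi/\lambda$ its frequency, and $\epsilon=\lambda/d$. The variables $\xi=x/d$ and $\zeta=\lambda z/d^2$ are the reduced versions of the transverse coordinate $x$ and the propagation coordinate $z\ge 0$, so that $\omega z=2\pi\zeta/\epsilon^2$. The coefficients $\hat g_n$ do not depend on $\epsilon$. The function $U_\epsilon$ is the solution of the Helmholtz equation in reduced variables and $U_{\mathrm{Par}}$ is the ideal paraxial solution; $U_{\mathrm{Par}}$ depends on $\epsilon$ only through the phase prefactor $e^{-i\omega z}=e^{-2\pi i\zeta/\epsilon^2}$. *)

theory Defs
  imports "HOL-Analysis.Analysis"
begin

definition square_integrable_on ::
  "(real \<Rightarrow> 'a::{banach, second_countable_topology}) \<Rightarrow> real set \<Rightarrow> bool"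
  where
  "square_integrable_on f S \<longleftrightarrow>
     set_borel_measurable lebesgue S f \<and>
     set_integrable lebesgue S (\<lambda>x. (norm (f x))\<^sup>2)"

definition grating_coeff :: "real \<Rightarrow> (real \<Rightarrow> real) \<Rightarrow> int \<Rightarrow> real" where
  "grating_coeff d g n =
     2 / d * (LINT x:{0..d/2}|lebesgue. g x * cos (2 * pi * real_of_int n * x / d))"

definition has_L2_fourier_series :: "(real \<Rightarrow> complex) \<Rightarrow> (int \<Rightarrow> complex) \<Rightarrow> bool" where
  "has_L2_fourier_series u c \<longleftrightarrow>
     square_integrable_on u {0..1} \<and>
     (\<lambda>N::nat. LINT \<xi>:{0..1}|lebesgue.
        (cmod (u \<xi> - (\<Sum>n\<in>{- int N..int N}.
           c n * exp (2 * of_real pi * \<i> * of_real \<xi> * of_int n))))\<^sup>2)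
       \<longlonglongrightarrow> 0"

text \<open>The sum of an \<open>L\<^sup>2\<close>-convergent Fourier series is determined only almost everywhere
  on \<open>[0,1]\<close>; the following picks a representative. It is meaningful
  when the coefficients are square-summable, and integrals over \<open>[0,1]\<close> do not depend
  on the choice.\<close>

definition L2_fourier_sum :: "(int \<Rightarrow> complex) \<Rightarrow> real \<Rightarrow> complex" where
  "L2_fourier_sum c = (SOME u. has_L2_fourier_series u c)"

text \<open>Propagating modes (\<open>\<bar>n\<bar> \<le> 1/\<epsilon>\<close>) acquire a phase, evanescent modes decay.\<close>

definition helmholtz_factor :: "real \<Rightarrow> real \<Rightarrow> int \<Rightarrow> complex" where
  "helmholtz_factor \<epsilon> \<zeta> n =
     (if \<bar>real_of_int n\<bar> \<le> 1 / \<epsilon>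
      then exp (- (2 * of_real pi * \<i> * of_real \<zeta> / (of_real \<epsilon>)\<^sup>2)
                 * of_real (sqrt (1 - (real_of_int n * \<epsilon>)\<^sup>2)))
      else of_real (exp (- (2 * pi * \<zeta> / \<epsilon>\<^sup>2) * sqrt ((real_of_int n * \<epsilon>)\<^sup>2 - 1))))"

definition U_eps :: "real \<Rightarrow> (real \<Rightarrow> real) \<Rightarrow> real \<Rightarrow> real \<Rightarrow> real \<Rightarrow> complex" where
  "U_eps d g \<epsilon> \<xi> \<zeta> =
     L2_fourier_sum (\<lambda>n. of_real (grating_coeff d g n) * helmholtz_factor \<epsilon> \<zeta> n) \<xi>"

definition U_Par :: "real \<Rightarrow> (real \<Rightarrow> real) \<Rightarrow> real \<Rightarrow> real \<Rightarrow> real \<Rightarrow> complex" where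
  "U_Par d g \<epsilon> \<xi> \<zeta> =
     exp (- (2 * of_real pi * \<i> * of_real \<zeta> / (of_real \<epsilon>)\<^sup>2)) *
     L2_fourier_sum
       (\<lambda>n. of_real (grating_coeff d g n) * exp (\<i> * of_real pi * of_real \<zeta> * (of_int n)\<^sup>2)) \<xi>"

end

theory Submission imports Defs begin

text \<open>
  Both functions have the coefficients \<open>c\<^sub>n\<close> of \<open>g\<close> multiplied by factors of modulus at most 1,
  so by orthonormality of the exponentials \<open>\<parallel>U\<^sub>\<epsilon> - U\<^sub>P\<^sub>a\<^sub>r\<parallel>\<^sup>2\<close> is controlled by
  \<open>\<Sum> \<bar>c\<^sub>n\<bar>\<^sup>2 \<bar>\<delta>\<^sub>n(\<epsilon>)\<bar>\<^sup>2\<close>, where \<open>\<delta>\<^sub>n(\<epsilon>)\<close> is the difference of the two factors.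
  For fixed \<open>n\<close> and \<open>r = sqrt (1 - n\<^sup>2\<epsilon>\<^sup>2)\<close>, the identity \<open>(1 - r) / \<epsilon>\<^sup>2 = n\<^sup>2 / (1 + r)\<close> shows that
  \<open>\<delta>\<^sub>n(\<epsilon>)\<close> tends to 0. As \<open>\<Sum> \<bar>c\<^sub>n\<bar>\<^sup>2\<close> is finite by Bessel's inequality for cosines on \<open>[0, d/2]\<close>,
  dominated convergence finishes the proof. That the two Fourier series converge at all is the
  Riesz-Fischer theorem.
\<close>

section \<open>Completeness of square-integrable functions\<close>

text \<open>A crude substitute for the triangle inequality in L2 that avoids square roots of
  integrals. The factors 2 are harmless, since only boundedness and null limits are derived from
  it.\<close>

lemma norm_add_square_le:
  fixes a b :: "'b::real_normed_vector"
  shows "(norm (a + b))\<^sup>2 \<le> 2 * (norm a)\<^sup>2 + 2 * (norm b)\<^sup>2"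
proof -
  have "(norm (a + b))\<^sup>2 \<le> (norm a + norm b)\<^sup>2"
    by (intro power_mono norm_triangle_ineq) auto
  also have "\<dots> \<le> 2 * (norm a)\<^sup>2 + 2 * (norm b)\<^sup>2"
    using sum_squares_bound[of "norm a" "norm b"] by (simp add: power2_sum)
  finally show ?thesis .
qed

lemma integrable_norm_square_add:
  fixes f g :: "'a \<Rightarrow> 'b::{banach, second_countable_topology}"
  assumes [measurable]: "f \<in> borel_measurable M" "g \<in> borel_measurable M"
    and "integrable M (\<lambda>x. (norm (f x))\<^sup>2)" "integrable M (\<lambda>x. (norm (g x))\<^sup>2)"
  shows "integrable M (\<lambda>x. (norm (f x + g x))\<^sup>2)"
proof (rule Bochner_Integration.integrable_bound)
  show "integrable M (\<lambda>x. 2 * (norm (f x))\<^sup>2 + 2 * (norm (g x))\<^sup>2)"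
    using assms by auto
  show "AE x in M. norm ((norm (f x + g x))\<^sup>2) \<le> norm (2 * (norm (f x))\<^sup>2 + 2 * (norm (g x))\<^sup>2)"
    using norm_add_square_le by auto
qed measurable

lemma integrable_norm_square_diff:
  fixes f g :: "'a \<Rightarrow> 'b::{banach, second_countable_topology}"
  assumes "f \<in> borel_measurable M" "g \<in> borel_measurable M"
    and "integrable M (\<lambda>x. (norm (f x))\<^sup>2)" "integrable M (\<lambda>x. (norm (g x))\<^sup>2)"
  shows "integrable M (\<lambda>x. (norm (f x - g x))\<^sup>2)"
  using integrable_norm_square_add[of f M "\<lambda>x. - g x"] assms by simp

text \<open>The classical Riesz-Fischer argument: a rapidly Cauchy subsequence converges almost
  everywhere, and Fatou's lemma carries the Cauchy bounds over to its limit.\<close>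

lemma L2_complete:
  fixes F :: "nat \<Rightarrow> 'a \<Rightarrow> 'b::{banach, second_countable_topology}"
  assumes meas [measurable]: "\<And>n. F n \<in> borel_measurable M"
    and int: "\<And>n. integrable M (\<lambda>x. (norm (F n x))\<^sup>2)"
    and Cauchy: "\<And>e. e > 0 \<Longrightarrow> \<exists>N. \<forall>m\<ge>N. \<forall>n\<ge>N. (LINT x|M. (norm (F m x - F n x))\<^sup>2) < e"
  obtains u where "u \<in> borel_measurable M" "integrable M (\<lambda>x. (norm (u x))\<^sup>2)"
    "(\<lambda>n. LINT x|M. (norm (u x - F n x))\<^sup>2) \<longlonglongrightarrow> 0"
proof -
  have intd: "integrable M (\<lambda>x. (norm (F m x - F n x))\<^sup>2)" for m n
    by (intro integrable_norm_square_diff meas int)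
  have nn: "(\<integral>\<^sup>+x. ennreal ((norm (F m x - F n x))\<^sup>2) \<partial>M)
      = ennreal (LINT x|M. (norm (F m x - F n x))\<^sup>2)" for m n
    by (intro nn_integral_eq_integral intd) auto
  obtain R where R: "\<And>e m n. e > 0 \<Longrightarrow> m \<ge> R e \<Longrightarrow> n \<ge> R e \<Longrightarrow>
      (LINT x|M. (norm (F m x - F n x))\<^sup>2) < e"
    using Cauchy by metis
  \<comment> \<open>The sum puts both \<open>r k\<close> and \<open>r (Suc k)\<close> beyond the
    threshold \<open>R ((1/8)^k)\<close>, and the summand \<open>k\<close> makes \<open>r\<close>
    tend to infinity. The rate 1/8 leaves 2^-k after multiplication by 4^k.\<close>
  define r where "r k = k + (\<Sum>j\<le>k. R ((1/8)^j))" for k :: nat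
  have r_ge: "R ((1/8)^j) \<le> r k" if "j \<le> k" for j k
    using member_le_sum[of j "{..k}" "\<lambda>j. R ((1/8)^j)"] that by (simp add: r_def)
  have r_le: "k \<le> r k" for k by (simp add: r_def)
  define D where "D k x = F (r (Suc k)) x - F (r k) x" for k x
  have [measurable]: "D k \<in> borel_measurable M" for k
    unfolding D_def by measurable
  txt \<open>Since \<open>\<Sum> 4\<^sup>k \<bar>D k x\<bar>\<^sup>2\<close> has finite integral, \<open>\<bar>D k x\<bar> \<le> 2\<^sup>-\<^sup>k\<close> eventually for almost every \<open>x\<close>.\<close>
  have DI: "(\<integral>\<^sup>+x. ennreal (4^k * (norm (D k x))\<^sup>2) \<partial>M) \<le> ennreal ((1/2)^k)" for k
  proof -
    have "(\<integral>\<^sup>+x. ennreal (4^k * (norm (D k x))\<^sup>2) \<partial>M)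
        = ennreal (4^k) * (\<integral>\<^sup>+x. ennreal ((norm (D k x))\<^sup>2) \<partial>M)"
      by (subst nn_integral_cmult[symmetric]) (auto simp: ennreal_mult)
    also have "\<dots> \<le> ennreal (4^k) * ennreal ((1/8)^k)"
      unfolding D_def nn
      by (intro mult_left_mono ennreal_leI less_imp_le[OF R]) (auto intro: r_ge)
    also have "\<dots> = ennreal (4^k * (1/8)^k)"
      by (rule ennreal_mult[symmetric]) auto
    also have "(4::real)^k * (1/8)^k = (1/2)^k"
      by (subst power_mult_distrib[symmetric]) simp
    finally show ?thesis .
  qed
  have "(\<integral>\<^sup>+x. (\<Sum>k. ennreal (4^k * (norm (D k x))\<^sup>2)) \<partial>M)
      = (\<Sum>k. \<integral>\<^sup>+x. ennreal (4^k * (norm (D k x))\<^sup>2) \<partial>M)"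
    by (rule nn_integral_suminf) measurable
  also have "\<dots> \<le> (\<Sum>k. ennreal ((1/2)^k))"
    by (intro suminf_le DI) auto
  also have "\<dots> = ennreal (\<Sum>k. (1/2)^k)"
    by (intro suminf_ennreal2 summable_geometric) auto
  also have "\<dots> < \<infinity>" by simp
  finally have "AE x in M. (\<Sum>k. ennreal (4^k * (norm (D k x))\<^sup>2)) \<noteq> \<infinity>"
    by (intro nn_integral_PInf_AE) auto
  then have conv: "AE x in M. convergent (\<lambda>k. F (r k) x)"
  proof eventually_elim
    case (elim x)
    have "summable (\<lambda>k. 4^k * (norm (D k x))\<^sup>2)"
      using elim by (intro summable_suminf_not_top) auto
    then have "(\<lambda>k. 4^k * (norm (D k x))\<^sup>2) \<longlonglongrightarrow> 0"
      by (rule summable_LIMSEQ_zero)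
    then have "eventually (\<lambda>k. 4^k * (norm (D k x))\<^sup>2 < 1) sequentially"
      by (rule order_tendstoD) auto
    then have "eventually (\<lambda>k. norm (D k x) \<le> (1/2)^k) sequentially"
    proof eventually_elim
      case (elim k)
      have "(2^k * norm (D k x))\<^sup>2 = 4^k * (norm (D k x))\<^sup>2"
        by (simp add: power2_eq_square flip: power_mult_distrib)
      with elim have "(2^k * norm (D k x))\<^sup>2 \<le> 1\<^sup>2"
        by simp
      then have "2^k * norm (D k x) \<le> 1"
        by (rule power2_le_imp_le) simp
      then show ?case by (simp add: field_simps power_one_over)
    qed
    then have "summable (\<lambda>k. D k x)"
      by (rule summable_comparison_test_ev) (auto intro: summable_geometric)
    then have "convergent (\<lambda>n. \<Sum>k<n. D k x)"
      by (simp add: summable_iff_convergent)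
    moreover have "(\<Sum>k<n. D k x) = F (r n) x - F (r 0) x" for n
      by (induction n) (simp_all add: D_def)
    ultimately have "convergent (\<lambda>n. F (r n) x - F (r 0) x)" by simp
    then have "convergent (\<lambda>n. (F (r n) x - F (r 0) x) + F (r 0) x)"
      by (intro convergent_add convergent_const)
    then show ?case by simp
  qed
  \<comment> \<open>Where the subsequence diverges, the value of \<open>lim\<close> is irrelevant:
    by \<open>conv\<close> this happens only on a null set.\<close>
  define u where "u x = lim (\<lambda>k. F (r k) x)" for x
  have u [measurable]: "u \<in> borel_measurable M"
    unfolding u_def by (intro borel_measurable_lim_metric) auto
  \<comment> \<open>Fatou's lemma along the subsequence: for \<open>k \<ge> R e\<close> also
    \<open>r k \<ge> R e\<close>, so the Cauchy bound holds for \<open>F (r k) - F n\<close> and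
    passes to the limit \<open>u - F n\<close>.\<close>
  have bound: "(\<integral>\<^sup>+x. ennreal ((norm (u x - F n x))\<^sup>2) \<partial>M) \<le> ennreal e"
    if "e > 0" "n \<ge> R e" for e n
  proof -
    have "(\<integral>\<^sup>+x. ennreal ((norm (u x - F n x))\<^sup>2) \<partial>M)
        = (\<integral>\<^sup>+x. liminf (\<lambda>k. ennreal ((norm (F (r k) x - F n x))\<^sup>2)) \<partial>M)"
    proof (rule nn_integral_cong_AE, use conv in eventually_elim)
      case (elim x)
      then have "(\<lambda>k. F (r k) x) \<longlonglongrightarrow> u x"
        unfolding u_def by (simp add: convergent_LIMSEQ_iff)
      then have "(\<lambda>k. ennreal ((norm (F (r k) x - F n x))\<^sup>2))
          \<longlonglongrightarrow> ennreal ((norm (u x - F n x))\<^sup>2)"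
        by (intro tendsto_intros tendsto_ennrealI)
      then show ?case
        by (metis lim_imp_Liminf trivial_limit_sequentially)
    qed
    also have "\<dots> \<le> liminf (\<lambda>k. \<integral>\<^sup>+x. ennreal ((norm (F (r k) x - F n x))\<^sup>2) \<partial>M)"
      by (rule nn_integral_liminf) measurable
    also have "\<dots> \<le> limsup (\<lambda>k. \<integral>\<^sup>+x. ennreal ((norm (F (r k) x - F n x))\<^sup>2) \<partial>M)"
      by (rule Liminf_le_Limsup) simp
    also have "\<dots> \<le> ennreal e"
    proof (rule Limsup_bounded)
      show "\<forall>\<^sub>F k in sequentially. (\<integral>\<^sup>+x. ennreal ((norm (F (r k) x - F n x))\<^sup>2) \<partial>M) \<le> ennreal e"
        using eventually_ge_at_top[of "R e"]
      proof eventually_elim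
        case (elim k)
        then show ?case unfolding nn
          using that r_le[of k] by (intro ennreal_leI less_imp_le[OF R]) auto
      qed
    qed
    finally show ?thesis .
  qed
  have intu: "integrable M (\<lambda>x. (norm (u x - F n x))\<^sup>2)" if "n \<ge> R 1" for n
    using bound[OF _ that] by (intro integrableI_bounded) (auto simp: le_less_trans)
  have "integrable M (\<lambda>x. (norm ((u x - F (R 1) x) + F (R 1) x))\<^sup>2)"
    by (intro integrable_norm_square_add intu int) auto
  then have "integrable M (\<lambda>x. (norm (u x))\<^sup>2)" by simp
  moreover have "(\<lambda>n. LINT x|M. (norm (u x - F n x))\<^sup>2) \<longlonglongrightarrow> 0"
  proof (rule LIMSEQ_I)
    fix e :: real assume e: "e > 0"
    \<comment> \<open>The index \<open>R 1\<close> ensures integrability, so that the nonnegative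
      integral is the Lebesgue integral; \<open>e/2\<close> makes the final inequality
      strict.\<close>
    have "norm ((LINT x|M. (norm (u x - F n x))\<^sup>2) - 0) < e" if "n \<ge> max (R 1) (R (e/2))" for n
    proof -
      have "ennreal (LINT x|M. (norm (u x - F n x))\<^sup>2) \<le> ennreal (e/2)"
        using bound[of "e/2" n] e that
        by (subst nn_integral_eq_integral[symmetric]) (auto intro: intu)
      then have "(LINT x|M. (norm (u x - F n x))\<^sup>2) \<le> e/2"
        using e by (simp add: ennreal_le_iff)
      moreover have "(LINT x|M. (norm (u x - F n x))\<^sup>2) \<ge> 0" by simp
      ultimately show ?thesis using e by simp
    qed
    then show "\<exists>no. \<forall>n\<ge>no. norm ((LINT x|M. (norm (u x - F n x))\<^sup>2) - 0) < e" by blast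
  qed
  ultimately show thesis using that u by blast
qed

section \<open>Fourier series on the unit interval\<close>

text \<open>Moves integrals over a set to the measure \<open>lebesgue_on S\<close>, to which the
  general L2 lemmas apply.\<close>

lemma set_lebesgue_integral_lebesgue_on:
  fixes f :: "'a::euclidean_space \<Rightarrow> 'b::{banach, second_countable_topology}"
  assumes "S \<in> sets lebesgue"
  shows "(LINT x:S|lebesgue. f x) = integral\<^sup>L (lebesgue_on S) f"
  using assms by (simp add: set_lebesgue_integral_def integral_restrict_space)

lemma square_integrable_on_iff:
  assumes "S \<in> sets lebesgue"
  shows "square_integrable_on f S \<longleftrightarrow>
    f \<in> borel_measurable (lebesgue_on S) \<and> integrable (lebesgue_on S) (\<lambda>x. (norm (f x))\<^sup>2)"
  using assms
  by (simp add: square_integrable_on_def set_borel_measurable_def set_integrable_def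
      borel_measurable_restrict_space_iff integrable_restrict_space)

text \<open>The index set is arbitrary, so that the difference of two nested partial sums is again
  of this form.\<close>

definition fourier_partial :: "(int \<Rightarrow> complex) \<Rightarrow> int set \<Rightarrow> real \<Rightarrow> complex" where
  "fourier_partial c A \<xi> = (\<Sum>n\<in>A. c n * exp (2 * of_real pi * \<i> * of_real \<xi> * of_int n))"

lemma has_L2_fourier_series_iff:
  "has_L2_fourier_series u c \<longleftrightarrow>
    u \<in> borel_measurable (lebesgue_on {0..1}) \<and>
    integrable (lebesgue_on {0..1}) (\<lambda>\<xi>. (cmod (u \<xi>))\<^sup>2) \<and>
    (\<lambda>N::nat. LINT \<xi>|lebesgue_on {0..1}. (cmod (u \<xi> - fourier_partial c {- int N..int N} \<xi>))\<^sup>2)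
      \<longlonglongrightarrow> 0"
  by (simp add: has_L2_fourier_series_def square_integrable_on_iff fourier_partial_def
      set_lebesgue_integral_lebesgue_on)

lemma continuous_on_fourier_partial [continuous_intros]: "continuous_on X (fourier_partial c A)"
  unfolding fourier_partial_def by (intro continuous_intros)

lemma fourier_partial_measurable [measurable]:
  "fourier_partial c A \<in> borel_measurable (lebesgue_on {0..1})"
  by (rule continuous_imp_measurable_on_sets_lebesgue) (auto intro: continuous_intros)

lemma integrable_fourier_partial:
  "integrable (lebesgue_on {0..1}) (\<lambda>\<xi>. (cmod (fourier_partial c A \<xi>))\<^sup>2)"
  by (intro continuous_imp_integrable_real continuous_intros)

lemma fourier_partial_diff:
  "fourier_partial a A \<xi> - fourier_partial b A \<xi> = fourier_partial (\<lambda>n. a n - b n) A \<xi>"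
  by (simp add: fourier_partial_def sum_subtractf algebra_simps)

lemma fourier_partial_subset_diff:
  assumes "finite B" "A \<subseteq> B"
  shows "fourier_partial c B \<xi> - fourier_partial c A \<xi> = fourier_partial c (B - A) \<xi>"
  using assms by (simp add: fourier_partial_def sum_diff)

text \<open>Orthonormality of the exponentials: for nonzero \<open>k\<close> the antiderivative
  \<open>exp (w * x) / w\<close> agrees at both endpoints because \<open>exp w = 1\<close>.\<close>

lemma integral_exp_int:
  "(LINT \<xi>|lebesgue_on {0..1}. exp (2 * of_real pi * \<i> * of_real \<xi> * of_int k)) = of_bool (k = 0)"
proof (cases "k = 0")
  case True
  then show ?thesis by (simp add: measure_restrict_space)
next
  case False
  define w where "w = 2 * of_real pi * \<i> * of_int k"
  have w: "w \<noteq> 0" using False by (simp add: w_def)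
  have e1: "exp w = 1"
    unfolding w_def exp_eq_1 by (auto intro!: exI[of _ k])
  have "((\<lambda>x. exp (w * of_real x)) has_integral exp (w * of_real 1) / w - exp (w * of_real 0) / w) {0..1}"
  proof (rule fundamental_theorem_of_calculus)
    fix x :: real
    have "((\<lambda>z. exp (w * z) / w) has_field_derivative exp (w * of_real x)) (at (of_real x))"
      using w by (auto intro!: derivative_eq_intros)
    then show "((\<lambda>x. exp (w * of_real x) / w) has_vector_derivative exp (w * of_real x))
        (at x within {0..1})"
      by (rule has_vector_derivative_real_field)
  qed simp
  then have "((\<lambda>x. exp (w * of_real x)) has_integral 0) {0..1}"
    using e1 by simp
  then have "integral {0..1} (\<lambda>x. exp (w * of_real x)) = 0"
    by (rule integral_unique)
  moreover have "integrable (lebesgue_on {0..1}) (\<lambda>x. exp (w * of_real x))"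
    by (intro continuous_imp_integrable_real continuous_intros)
  ultimately have "(LINT x|lebesgue_on {0..1}. exp (w * of_real x)) = 0"
    by (simp add: lebesgue_integral_eq_integral)
  then show ?thesis
    using False by (simp add: w_def mult_ac)
qed

text \<open>Parseval's identity for trigonometric polynomials: in the expanded product with the
  conjugate only the diagonal terms survive integration.\<close>

lemma integral_fourier_partial_square:
  assumes "finite A"
  shows "(LINT \<xi>|lebesgue_on {0..1}. (cmod (fourier_partial c A \<xi>))\<^sup>2) = (\<Sum>n\<in>A. (cmod (c n))\<^sup>2)"
proof -
  let ?M = "lebesgue_on {0..1::real}"
  let ?e = "\<lambda>k \<xi>. exp (2 * of_real pi * \<i> * of_real \<xi> * of_int k)"
  have int: "integrable ?M (?e k)" for k :: int
    by (intro continuous_imp_integrable_real continuous_intros)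
  have "of_real ((cmod (fourier_partial c A \<xi>))\<^sup>2)
      = (\<Sum>n\<in>A. \<Sum>m\<in>A. c n * cnj (c m) * ?e (n - m) \<xi>)" for \<xi>
  proof -
    have *: "?e n \<xi> * cnj (?e m \<xi>) = ?e (n - m) \<xi>" for n m
      unfolding exp_cnj exp_add[symmetric] by (rule arg_cong[where f = exp]) (simp add: algebra_simps)
    have "of_real ((cmod (fourier_partial c A \<xi>))\<^sup>2)
        = (\<Sum>n\<in>A. \<Sum>m\<in>A. (c n * ?e n \<xi>) * cnj (c m * ?e m \<xi>))"
      unfolding complex_norm_square fourier_partial_def cnj_sum sum_product ..
    also have "\<dots> = (\<Sum>n\<in>A. \<Sum>m\<in>A. c n * cnj (c m) * (?e n \<xi> * cnj (?e m \<xi>)))"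
      by (simp add: mult_ac)
    finally show ?thesis unfolding * .
  qed
  then have "of_real (LINT \<xi>|?M. (cmod (fourier_partial c A \<xi>))\<^sup>2)
      = (LINT \<xi>|?M. (\<Sum>n\<in>A. \<Sum>m\<in>A. c n * cnj (c m) * ?e (n - m) \<xi>))"
    by (subst integral_complex_of_real[symmetric]) simp
  also have "\<dots> = (\<Sum>n\<in>A. \<Sum>m\<in>A. c n * cnj (c m) * (LINT \<xi>|?M. ?e (n - m) \<xi>))"
    by (simp add: Bochner_Integration.integral_sum int del: of_int_diff)
  also have "\<dots> = (\<Sum>n\<in>A. \<Sum>m\<in>A. if n = m then c n * cnj (c m) else 0)"
    unfolding integral_exp_int by (intro sum.cong) auto
  also have "\<dots> = of_real (\<Sum>n\<in>A. (cmod (c n))\<^sup>2)"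
    using assms by (simp add: complex_norm_square del: of_real_power)
  finally show ?thesis by (simp only: of_real_eq_iff)
qed

text \<open>By Parseval, squared distances of symmetric partial sums are differences of terms of a
  bounded increasing sequence, so the partial sums are Cauchy in L2. Completeness supplies a sum,
  and the choice in \<open>L2_fourier_sum\<close> is therefore meaningful.\<close>

lemma L2_fourier_sum_has_series:
  assumes bound: "\<And>N::nat. (\<Sum>n\<in>{- int N..int N}. (cmod (c n))\<^sup>2) \<le> B"
  shows "has_L2_fourier_series (L2_fourier_sum c) c"
proof -
  let ?M = "lebesgue_on {0..1::real}"
  define a where "a N = (\<Sum>n\<in>{- int N..int N}. (cmod (c n))\<^sup>2)" for N :: nat
  define S where "S N = fourier_partial c {- int N..int N}" for N :: nat
  have dist_le: "(LINT \<xi>|?M. (cmod (S m \<xi> - S n \<xi>))\<^sup>2) = a m - a n" if "n \<le> m" for m n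
  proof -
    have sub: "{- int n..int n} \<subseteq> {- int m..int m}" using that by auto
    have "(LINT \<xi>|?M. (cmod (S m \<xi> - S n \<xi>))\<^sup>2)
        = (\<Sum>n\<in>{- int m..int m} - {- int n..int n}. (cmod (c n))\<^sup>2)"
      using sub by (simp add: S_def fourier_partial_subset_diff integral_fourier_partial_square)
    also have "\<dots> = a m - a n"
      using sub by (simp add: a_def sum_diff)
    finally show ?thesis .
  qed
  have "incseq a"
    unfolding incseq_def a_def by (auto intro!: sum_mono2)
  moreover have "range a \<subseteq> {0..B}"
    using bound by (auto simp: a_def intro!: sum_nonneg)
  ultimately have "convergent a"
    by (metis Bseq_eq_bounded Bseq_mono_convergent bounded_closed_interval bounded_subset incseq_def)
  then have "Cauchy a" by (simp add: Cauchy_convergent_iff)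
  obtain u where "u \<in> borel_measurable ?M" "integrable ?M (\<lambda>x. (cmod (u x))\<^sup>2)"
    "(\<lambda>n. LINT x|?M. (cmod (u x - S n x))\<^sup>2) \<longlonglongrightarrow> 0"
  proof (rule L2_complete[of S ?M])
    fix e :: real assume "e > 0"
    then obtain N where N: "\<And>m n. m \<ge> N \<Longrightarrow> n \<ge> N \<Longrightarrow> dist (a m) (a n) < e"
      using \<open>Cauchy a\<close> by (meson metric_CauchyD)
    have "(LINT x|?M. (cmod (S m x - S n x))\<^sup>2) < e" if "m \<ge> N" "n \<ge> N" for m n
    proof (cases "n \<le> m")
      case True
      then show ?thesis
        using N[OF that] by (simp add: dist_le dist_real_def)
    next
      case False
      then show ?thesis
        using N[OF that] by (subst norm_minus_commute) (simp add: dist_le dist_real_def)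
    qed
    then show "\<exists>N. \<forall>m\<ge>N. \<forall>n\<ge>N. (LINT x|?M. (cmod (S m x - S n x))\<^sup>2) < e" by blast
  qed (auto simp: S_def integrable_fourier_partial)
  then have "has_L2_fourier_series u c"
    by (simp add: has_L2_fourier_series_iff S_def)
  then show ?thesis
    unfolding L2_fourier_sum_def by (rule someI[of "\<lambda>u. has_L2_fourier_series u c"])
qed

text \<open>Serves the phase prefactor of \<open>U_Par\<close>, which stands outside
  \<open>L2_fourier_sum\<close>: multiplying the chosen representative gives some sum of the
  multiplied series, though not necessarily the chosen one.\<close>

lemma has_L2_fourier_series_cmult:
  assumes "has_L2_fourier_series u c"
  shows "has_L2_fourier_series (\<lambda>\<xi>. w * u \<xi>) (\<lambda>n. w * c n)"
proof -
  have *: "w * u \<xi> - fourier_partial (\<lambda>n. w * c n) A \<xi> = w * (u \<xi> - fourier_partial c A \<xi>)" for A \<xi>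
    by (simp add: fourier_partial_def sum_distrib_left algebra_simps)
  have "(\<lambda>N::nat. (cmod w)\<^sup>2 *
      (LINT \<xi>|lebesgue_on {0..1}. (cmod (u \<xi> - fourier_partial c {- int N..int N} \<xi>))\<^sup>2))
      \<longlonglongrightarrow> (cmod w)\<^sup>2 * 0"
    using assms by (intro tendsto_intros) (simp add: has_L2_fourier_series_iff)
  then show ?thesis
    using assms
    by (auto simp: has_L2_fourier_series_iff * norm_mult power_mult_distrib
        intro: borel_measurable_times)
qed

text \<open>Splits \<open>u - v\<close> into the two truncation errors, which vanish as
  \<open>N\<close> grows, and a trigonometric polynomial whose norm Parseval gives. It holds for all
  representatives \<open>u\<close> and \<open>v\<close>.\<close>

lemma L2_distance_le_coeff_distance:
  assumes u: "has_L2_fourier_series u a" and v: "has_L2_fourier_series v b"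
    and K: "\<And>N::nat. (\<Sum>n\<in>{- int N..int N}. (cmod (a n - b n))\<^sup>2) \<le> K"
  shows "(LINT \<xi>|lebesgue_on {0..1}. (cmod (u \<xi> - v \<xi>))\<^sup>2) \<le> 4 * K"
proof -
  let ?M = "lebesgue_on {0..1::real}"
  define A where "A N = {- int N..int N}" for N :: nat
  define p where "p N \<xi> = u \<xi> - fourier_partial a (A N) \<xi>" for N \<xi>
  define q where "q N \<xi> = v \<xi> - fourier_partial b (A N) \<xi>" for N \<xi>
  define s where "s N = fourier_partial (\<lambda>n. a n - b n) (A N)" for N
  have [measurable]: "u \<in> borel_measurable ?M" "v \<in> borel_measurable ?M"
    and iu: "integrable ?M (\<lambda>\<xi>. (cmod (u \<xi>))\<^sup>2)" and iv: "integrable ?M (\<lambda>\<xi>. (cmod (v \<xi>))\<^sup>2)"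
    using u v by (auto simp: has_L2_fourier_series_iff)
  have [measurable]: "p N \<in> borel_measurable ?M" "q N \<in> borel_measurable ?M"
      "s N \<in> borel_measurable ?M" for N
    unfolding p_def q_def s_def by measurable
  have ip: "integrable ?M (\<lambda>\<xi>. (cmod (p N \<xi>))\<^sup>2)" for N
    unfolding p_def by (intro integrable_norm_square_diff integrable_fourier_partial iu) auto
  have iq: "integrable ?M (\<lambda>\<xi>. (cmod (q N \<xi>))\<^sup>2)" for N
    unfolding q_def by (intro integrable_norm_square_diff integrable_fourier_partial iv) auto
  have is': "integrable ?M (\<lambda>\<xi>. (cmod (s N \<xi>))\<^sup>2)" for N
    unfolding s_def by (rule integrable_fourier_partial)
  have "(LINT \<xi>|?M. (cmod (u \<xi> - v \<xi>))\<^sup>2)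
      \<le> 4 * (LINT \<xi>|?M. (cmod (p N \<xi>))\<^sup>2) + 4 * (LINT \<xi>|?M. (cmod (q N \<xi>))\<^sup>2) + 4 * K" for N
  proof -
    \<comment> \<open>Two applications of \<open>norm_add_square_le\<close> give the coefficients 4,
      4 and 2; the last is enlarged to 4.\<close>
    have "(cmod (u \<xi> - v \<xi>))\<^sup>2 \<le> 4 * (cmod (p N \<xi>))\<^sup>2 + 4 * (cmod (q N \<xi>))\<^sup>2 + 4 * (cmod (s N \<xi>))\<^sup>2" for \<xi>
    proof -
      have "u \<xi> - v \<xi> = (p N \<xi> + - q N \<xi>) + s N \<xi>"
        by (simp add: p_def q_def s_def fourier_partial_diff[symmetric])
      then show ?thesis
        using norm_add_square_le[of "p N \<xi> + - q N \<xi>" "s N \<xi>"] norm_add_square_le[of "p N \<xi>" "- q N \<xi>"]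
          zero_le_power2[of "cmod (s N \<xi>)"]
        by (simp only: norm_minus_cancel)
    qed
    then have "(LINT \<xi>|?M. (cmod (u \<xi> - v \<xi>))\<^sup>2)
        \<le> (LINT \<xi>|?M. 4 * (cmod (p N \<xi>))\<^sup>2 + 4 * (cmod (q N \<xi>))\<^sup>2 + 4 * (cmod (s N \<xi>))\<^sup>2)"
      using ip iq is' iu iv by (intro integral_mono integrable_norm_square_diff) auto
    also have "\<dots> = 4 * (LINT \<xi>|?M. (cmod (p N \<xi>))\<^sup>2) + 4 * (LINT \<xi>|?M. (cmod (q N \<xi>))\<^sup>2)
        + 4 * (LINT \<xi>|?M. (cmod (s N \<xi>))\<^sup>2)"
      using ip iq is' by simp
    also have "(LINT \<xi>|?M. (cmod (s N \<xi>))\<^sup>2) \<le> K"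
      using K[of N] by (simp add: s_def A_def integral_fourier_partial_square)
    finally show ?thesis by simp
  qed
  moreover have "(\<lambda>N. 4 * (LINT \<xi>|?M. (cmod (p N \<xi>))\<^sup>2) + 4 * (LINT \<xi>|?M. (cmod (q N \<xi>))\<^sup>2) + 4 * K)
      \<longlonglongrightarrow> 4 * 0 + 4 * 0 + 4 * K"
    using u v unfolding p_def q_def A_def
    by (intro tendsto_intros) (auto simp: has_L2_fourier_series_iff)
  ultimately show ?thesis
    by (intro LIMSEQ_le_const) auto
qed

section \<open>Bessel inequality for the grating coefficients\<close>

text \<open>The antiderivative \<open>sin (w * x) / w\<close> vanishes at both ends, since
  \<open>w * (d / 2)\<close> is an integer multiple of \<open>pi\<close>.\<close>

lemma integral_cos_half_period:
  assumes d: "d > 0"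
  shows "(LINT x|lebesgue_on {0..d/2}. cos (2 * pi * real_of_int k * x / d)) = d / 2 * of_bool (k = 0)"
proof (cases "k = 0")
  case True
  then show ?thesis using d by (simp add: measure_restrict_space)
next
  case False
  define w where "w = 2 * pi * real_of_int k / d"
  have w: "w \<noteq> 0" using False d by (simp add: w_def)
  have "w * (d / 2) = pi * real_of_int k" using d by (simp add: w_def)
  then have s1: "sin (w * (d / 2)) = 0" by (simp add: sin_zero_iff_int2)
  have "((\<lambda>x. cos (w * x)) has_integral sin (w * (d / 2)) / w - sin (w * 0) / w) {0..d/2}"
  proof (rule fundamental_theorem_of_calculus)
    fix x :: real
    have "((\<lambda>x. sin (w * x) / w) has_real_derivative cos (w * x)) (at x within {0..d/2})"
      using w by (auto intro!: derivative_eq_intros)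
    then show "((\<lambda>x. sin (w * x) / w) has_vector_derivative cos (w * x)) (at x within {0..d/2})"
      by (simp add: has_real_derivative_iff_has_vector_derivative)
  qed (use d in simp)
  then have "integral {0..d/2} (\<lambda>x. cos (w * x)) = 0"
    using s1 by (simp add: integral_unique)
  moreover have "integrable (lebesgue_on {0..d/2}) (\<lambda>x. cos (w * x))"
    by (intro continuous_imp_integrable_real continuous_intros)
  ultimately have "(LINT x|lebesgue_on {0..d/2}. cos (w * x)) = 0"
    by (simp add: lebesgue_integral_eq_integral)
  then show ?thesis
    using False by (simp add: w_def)
qed

text \<open>Product-to-sum formula. The second indicator appears because the indices
  \<open>n\<close> and \<open>- n\<close> give the same cosine.\<close>

lemma integral_cos_mult_cos_half_period:
  assumes d: "d > 0"
  shows "(LINT x|lebesgue_on {0..d/2}. cos (2 * pi * real_of_int n * x / d) * cos (2 * pi * real_of_int m * x / d))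
      = d / 4 * (of_bool (n = m) + of_bool (n = - m))"
proof -
  let ?M = "lebesgue_on {0..d/2}"
  have int: "integrable ?M (\<lambda>x. cos (2 * pi * real_of_int k * x / d))" for k
    using d by (intro continuous_imp_integrable_real continuous_intros) auto
  have eq: "cos (2 * pi * real_of_int n * x / d) * cos (2 * pi * real_of_int m * x / d)
      = (cos (2 * pi * real_of_int (n - m) * x / d) + cos (2 * pi * real_of_int (n + m) * x / d)) / 2" for x
    unfolding cos_times_cos by (simp add: diff_divide_distrib add_divide_distrib algebra_simps)
  have "(LINT x|?M. cos (2 * pi * real_of_int n * x / d) * cos (2 * pi * real_of_int m * x / d))
      = ((LINT x|?M. cos (2 * pi * real_of_int (n - m) * x / d))
        + (LINT x|?M. cos (2 * pi * real_of_int (n + m) * x / d))) / 2"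
    unfolding eq by (simp add: int del: of_int_add of_int_diff)
  also have "\<dots> = d / 4 * (of_bool (n = m) + of_bool (n = - m))"
    unfolding integral_cos_half_period[OF d] by (auto simp: eq_neg_iff_add_eq_0)
  finally show ?thesis .
qed

lemma grating_coeff_uminus: "grating_coeff d g (- n) = grating_coeff d g n"
proof -
  have "cos (2 * pi * real_of_int (- n) * x / d) = cos (2 * pi * real_of_int n * x / d)" for x
    using cos_minus[of "2 * pi * real_of_int n * x / d"] by simp
  then show ?thesis unfolding grating_coeff_def by (simp only:)
qed

text \<open>Expands the nonnegative integral of \<open>(g - S)\<^sup>2\<close>. Over a symmetric
  index range the integrals of \<open>g * S\<close> and \<open>S\<^sup>2\<close> are both d/2 times
  the square sum, which leaves a bound independent of \<open>N\<close>.\<close>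

lemma grating_coeff_Bessel:
  assumes d: "d > 0" and g: "square_integrable_on g {0..d}"
  shows "(\<Sum>n\<in>{- int N..int N}. (grating_coeff d g n)\<^sup>2)
    \<le> 2 / d * (LINT x|lebesgue_on {0..d/2}. (g x)\<^sup>2)"
proof -
  let ?M = "lebesgue_on {0..d/2}"
  define C where "C n x = cos (2 * pi * real_of_int n * x / d)" for n and x :: real
  define A where "A = {- int N..int N}"
  define a where "a = grating_coeff d g"
  define S where "S x = (\<Sum>n\<in>A. a n * C n x)" for x
  interpret finite_measure ?M
    by (intro finite_measure_lebesgue_on) auto
  have sub: "{0..d/2} \<subseteq> {0..d}" using d by auto
  have g': "g \<in> borel_measurable (lebesgue_on {0..d})"
    "integrable (lebesgue_on {0..d}) (\<lambda>x. (g x)\<^sup>2)"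
    using g by (auto simp: square_integrable_on_iff)
  have [measurable]: "g \<in> borel_measurable ?M"
    by (rule measurable_restrict_mono[OF g'(1) sub])
  have gI: "integrable ?M (\<lambda>x. (g x)\<^sup>2)"
    by (rule integrable_subinterval[OF g'(2) sub])
  have contC: "continuous_on X (C n)" for X n
    unfolding C_def using d by (intro continuous_intros) auto
  have [measurable]: "C n \<in> borel_measurable ?M" for n
    by (rule continuous_imp_measurable_on_sets_lebesgue[OF contC]) auto
  \<comment> \<open>On a finite measure space the dominating function \<open>1 + g\<^sup>2\<close>
    is integrable.\<close>
  have gC: "integrable ?M (\<lambda>x. g x * C n x)" for n
  proof (rule Bochner_Integration.integrable_bound)
    show "integrable ?M (\<lambda>x. 1 + (g x)\<^sup>2)" using gI by simp
    have "\<bar>g x * C n x\<bar> \<le> 1 + (g x)\<^sup>2" for x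
    proof -
      have "\<bar>g x * C n x\<bar> \<le> \<bar>g x\<bar> * 1"
        unfolding abs_mult C_def by (intro mult_left_mono abs_cos_le_one) auto
      also have "\<dots> \<le> 1 + (g x)\<^sup>2"
        using sum_squares_bound[of "\<bar>g x\<bar>" 1] by simp
      finally show ?thesis .
    qed
    then show "AE x in ?M. norm (g x * C n x) \<le> norm (1 + (g x)\<^sup>2)" by simp
  qed measurable
  have CC: "integrable ?M (\<lambda>x. C n x * C m x)" for n m
    by (intro continuous_imp_integrable_real continuous_intros contC)
  have a: "(LINT x|?M. g x * C n x) = d / 2 * a n" for n
    using d by (simp add: a_def grating_coeff_def C_def set_lebesgue_integral_lebesgue_on)
  have intC: "(LINT x|?M. C n x * C m x) = d / 4 * (of_bool (n = m) + of_bool (n = - m))" for n m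
    unfolding C_def by (rule integral_cos_mult_cos_half_period[OF d])
  have gSx: "g x * S x = (\<Sum>n\<in>A. a n * (g x * C n x))" for x
    by (simp add: S_def sum_distrib_left mult_ac)
  have SSx: "(S x)\<^sup>2 = (\<Sum>n\<in>A. \<Sum>m\<in>A. a n * a m * (C n x * C m x))" for x
    by (simp add: S_def power2_eq_square sum_product mult_ac)
  have igS: "integrable ?M (\<lambda>x. g x * S x)" and iSS: "integrable ?M (\<lambda>x. (S x)\<^sup>2)"
    unfolding gSx SSx by (auto intro!: Bochner_Integration.integrable_sum gC CC)
  have "(LINT x|?M. g x * S x) = d / 2 * (\<Sum>n\<in>A. (a n)\<^sup>2)"
    unfolding gSx using gC by (simp add: a sum_distrib_left power2_eq_square mult_ac)
  moreover have "(LINT x|?M. (S x)\<^sup>2) = d / 2 * (\<Sum>n\<in>A. (a n)\<^sup>2)"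
  proof -
    have "(LINT x|?M. (S x)\<^sup>2)
        = (\<Sum>n\<in>A. \<Sum>m\<in>A. a n * a m * (d / 4 * (of_bool (n = m) + of_bool (n = - m))))"
      unfolding SSx using CC by (simp add: intC Bochner_Integration.integral_sum)
    also have "\<dots> = (\<Sum>n\<in>A. d / 2 * (a n)\<^sup>2)"
    proof (rule sum.cong[OF refl])
      fix n assume n: "n \<in> A"
      then have n': "- n \<in> A" by (auto simp: A_def)
      \<comment> \<open>The terms \<open>m = n\<close> and \<open>m = - n\<close> contribute equally
        because \<open>a (- n) = a n\<close>; for \<open>n = 0\<close> both indicators fall on the
        same term, with the same total.\<close>
      have "(\<Sum>m\<in>A. a n * a m * (d / 4 * (of_bool (n = m) + of_bool (n = - m))))
          = (\<Sum>m\<in>A. if n = m then d / 4 * a n * a m else 0) + (\<Sum>m\<in>A. if - n = m then d / 4 * a n * a m else 0)"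
        unfolding sum.distrib[symmetric] by (intro sum.cong) (auto simp: algebra_simps)
      also have "\<dots> = d / 4 * a n * a n + d / 4 * a n * a (- n)"
        using n n' by (simp add: A_def)
      also have "a (- n) = a n" by (simp add: a_def grating_coeff_uminus)
      finally show "(\<Sum>m\<in>A. a n * a m * (d / 4 * (of_bool (n = m) + of_bool (n = - m)))) = d / 2 * (a n)\<^sup>2"
        by (simp add: power2_eq_square)
    qed
    finally show ?thesis by (simp add: sum_distrib_left)
  qed
  moreover have "0 \<le> (LINT x|?M. (g x - S x)\<^sup>2)" by simp
  moreover have "(LINT x|?M. (g x - S x)\<^sup>2)
      = (LINT x|?M. (g x)\<^sup>2) + (LINT x|?M. (S x)\<^sup>2) - 2 * (LINT x|?M. g x * S x)"
    using gI iSS igS by (simp add: power2_diff mult.assoc)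
  ultimately have "d / 2 * (\<Sum>n\<in>A. (a n)\<^sup>2) \<le> (LINT x|?M. (g x)\<^sup>2)" by simp
  then show ?thesis
    using d by (simp add: a_def A_def field_simps)
qed

section \<open>The paraxial limit of the modes\<close>

text \<open>The phase prefactor is absorbed into every mode, so that the two functions can be
  compared coefficient by coefficient.\<close>

definition paraxial_factor :: "real \<Rightarrow> real \<Rightarrow> int \<Rightarrow> complex" where
  "paraxial_factor \<epsilon> \<zeta> n =
    exp (- (2 * of_real pi * \<i> * of_real \<zeta> / (of_real \<epsilon>)\<^sup>2)) *
    exp (\<i> * of_real pi * of_real \<zeta> * (of_int n)\<^sup>2)"

text \<open>Propagating modes have modulus 1; for evanescent modes \<zeta> \<ge> 0 makes the real
  exponent nonpositive.\<close>

lemma norm_helmholtz_factor_le: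
  assumes "\<zeta> \<ge> 0" "\<epsilon> > 0"
  shows "cmod (helmholtz_factor \<epsilon> \<zeta> n) \<le> 1"
proof (cases "\<bar>real_of_int n\<bar> \<le> 1 / \<epsilon>")
  case True
  have "helmholtz_factor \<epsilon> \<zeta> n
      = exp (\<i> * of_real (- (2 * pi * \<zeta> / \<epsilon>\<^sup>2) * sqrt (1 - (real_of_int n * \<epsilon>)\<^sup>2)))"
    using True by (simp add: helmholtz_factor_def mult_ac)
  then show ?thesis by (simp only: norm_exp_i_times order_refl)
next
  case False
  then have "1 \<le> \<bar>real_of_int n * \<epsilon>\<bar>"
    using \<open>\<epsilon> > 0\<close> by (simp add: abs_mult field_simps)
  then have "(real_of_int n * \<epsilon>)\<^sup>2 - 1 \<ge> 0"
    using power_mono[of 1 "\<bar>real_of_int n * \<epsilon>\<bar>" 2] by simp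
  then have "2 * pi * \<zeta> / \<epsilon>\<^sup>2 * sqrt ((real_of_int n * \<epsilon>)\<^sup>2 - 1) \<ge> 0"
    using assms by simp
  moreover have "helmholtz_factor \<epsilon> \<zeta> n
      = of_real (exp (- (2 * pi * \<zeta> / \<epsilon>\<^sup>2 * sqrt ((real_of_int n * \<epsilon>)\<^sup>2 - 1))))"
    using False by (simp add: helmholtz_factor_def)
  ultimately show ?thesis
    by (simp only: norm_of_real abs_exp_cancel exp_le_one_iff neg_le_0_iff_le)
qed

lemma paraxial_factor_eq:
  "paraxial_factor \<epsilon> \<zeta> n
    = exp (\<i> * of_real (- (2 * pi * \<zeta> / \<epsilon>\<^sup>2) + pi * \<zeta> * (real_of_int n)\<^sup>2))"
  by (simp add: paraxial_factor_def algebra_simps flip: exp_add)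

lemma norm_paraxial_factor: "cmod (paraxial_factor \<epsilon> \<zeta> n) = 1"
  unfolding paraxial_factor_eq by (rule norm_exp_i_times)

lemma helmholtz_factor_paraxial_limit:
  "((\<lambda>\<epsilon>. helmholtz_factor \<epsilon> \<zeta> n - paraxial_factor \<epsilon> \<zeta> n) \<longlongrightarrow> 0) (at_right 0)"
proof (rule Lim_null_comparison)
  let ?r = "\<lambda>\<epsilon>. sqrt (1 - (real_of_int n * \<epsilon>)\<^sup>2)"
  define t where "t = (real_of_int n)\<^sup>2"
  \<comment> \<open>The dominating expression is continuous at \<epsilon> = 0, where the square root
    is 1 and \<open>2 / (1 + 1) - 1\<close> vanishes.\<close>
  have "((\<lambda>\<epsilon>. cmod (exp (\<i> * of_real (pi * \<zeta> * t * (2 / (1 + ?r \<epsilon>) - 1))) - 1))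
      \<longlongrightarrow> cmod (exp (\<i> * of_real (pi * \<zeta> * t * (2 / (1 + ?r 0) - 1))) - 1)) (at_right 0)"
    by (intro tendsto_intros) auto
  then show "((\<lambda>\<epsilon>. cmod (exp (\<i> * of_real (pi * \<zeta> * t * (2 / (1 + ?r \<epsilon>) - 1))) - 1)) \<longlongrightarrow> 0)
      (at_right 0)"
    by simp
  \<comment> \<open>Below this threshold mode \<open>n\<close> is propagating, so both factors are
    pure phases; the added 1 covers \<open>n = 0\<close>.\<close>
  have "eventually (\<lambda>\<epsilon>. \<epsilon> < 1 / (\<bar>real_of_int n\<bar> + 1)) (at_right 0)"
    by (rule order_tendstoD[OF tendsto_ident_at]) simp
  then show "\<forall>\<^sub>F \<epsilon> in at_right 0. cmod (helmholtz_factor \<epsilon> \<zeta> n - paraxial_factor \<epsilon> \<zeta> n)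
      \<le> cmod (exp (\<i> * of_real (pi * \<zeta> * t * (2 / (1 + ?r \<epsilon>) - 1))) - 1)"
    using eventually_at_right_less[of 0]
  proof eventually_elim
    case (elim \<epsilon>)
    then have n\<epsilon>: "\<bar>real_of_int n\<bar> * \<epsilon> \<le> 1" by (simp add: field_simps)
    then have n: "\<bar>real_of_int n\<bar> \<le> 1 / \<epsilon>" using elim by (simp add: field_simps)
    define r where "r = ?r \<epsilon>"
    have "(real_of_int n * \<epsilon>)\<^sup>2 \<le> 1"
      using n\<epsilon> elim by (simp add: abs_square_le_1 abs_mult)
    then have r: "r\<^sup>2 = 1 - t * \<epsilon>\<^sup>2" "r \<ge> 0"
      by (auto simp: r_def t_def power_mult_distrib)
    define x where "x = - (2 * pi * \<zeta> / \<epsilon>\<^sup>2) * r"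
    define y where "y = - (2 * pi * \<zeta> / \<epsilon>\<^sup>2) + pi * \<zeta> * t"
    have H: "helmholtz_factor \<epsilon> \<zeta> n = exp (\<i> * of_real x)"
      using n by (simp add: helmholtz_factor_def x_def r_def mult_ac)
    have P: "paraxial_factor \<epsilon> \<zeta> n = exp (\<i> * of_real y)"
      unfolding paraxial_factor_eq y_def t_def ..
    \<comment> \<open>Rationalising the square root cancels the singular 1/\<epsilon>^2 in the phase
      difference.\<close>
    have "(1 - r) * (1 + r) = t * \<epsilon>\<^sup>2"
      using r by (simp add: power2_eq_square algebra_simps)
    then have r': "(1 - r) / \<epsilon>\<^sup>2 = t / (1 + r)"
      using r(2) elim by (simp add: frac_eq_eq)
    have "x - y = 2 * pi * \<zeta> * ((1 - r) / \<epsilon>\<^sup>2) - pi * \<zeta> * t"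
      by (simp add: x_def y_def diff_divide_distrib algebra_simps)
    also have "\<dots> = pi * \<zeta> * t * (2 / (1 + r) - 1)"
      unfolding r' by (simp add: algebra_simps)
    finally have xy: "x - y = pi * \<zeta> * t * (2 / (1 + r) - 1)" .
    have "exp (\<i> * of_real x) - exp (\<i> * of_real y) = exp (\<i> * of_real y) * (exp (\<i> * of_real (x - y)) - 1)"
      by (simp add: algebra_simps flip: exp_add)
    then have "cmod (helmholtz_factor \<epsilon> \<zeta> n - paraxial_factor \<epsilon> \<zeta> n) = cmod (exp (\<i> * of_real (x - y)) - 1)"
      unfolding H P by (simp only: norm_mult norm_exp_i_times mult_1)
    then show ?case
      unfolding xy r_def by simp
  qed
qed

section \<open>Dominated convergence for weighted square sums\<close>

text \<open>The symmetric partial sums increase and are bounded; once one of them is within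
  \<open>e\<close> of the supremum, all that can still be added is less than
  \<open>e\<close>.\<close>

lemma symmetric_square_sum_tail:
  fixes c :: "int \<Rightarrow> complex"
  assumes B: "\<And>N::nat. (\<Sum>n\<in>{- int N..int N}. (cmod (c n))\<^sup>2) \<le> B" and "e > 0"
  obtains m :: nat where
    "\<And>N::nat. (\<Sum>n\<in>{- int N..int N} - {- int m..int m}. (cmod (c n))\<^sup>2) < e"
proof -
  define a where "a N = (\<Sum>n\<in>{- int N..int N}. (cmod (c n))\<^sup>2)" for N :: nat
  have bdd: "bdd_above (range a)"
    using B by (intro bdd_aboveI2) (auto simp: a_def)
  obtain m where m: "(SUP N. a N) - e < a m"
    using less_cSUP_iff[OF _ bdd, of "(SUP N. a N) - e"] \<open>e > 0\<close> by auto
  have "(\<Sum>n\<in>{- int N..int N} - {- int m..int m}. (cmod (c n))\<^sup>2) < e" for N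
  proof -
    \<comment> \<open>Enlarging \<open>N\<close> to at least \<open>m\<close> makes the index ranges
      nested, so the sum becomes a difference of partial sums.\<close>
    let ?M = "max N m"
    have "(\<Sum>n\<in>{- int N..int N} - {- int m..int m}. (cmod (c n))\<^sup>2)
        \<le> (\<Sum>n\<in>{- int ?M..int ?M} - {- int m..int m}. (cmod (c n))\<^sup>2)"
      by (intro sum_mono2) auto
    also have "\<dots> = a ?M - a m"
      unfolding a_def by (intro sum_diff) auto
    also have "\<dots> < e"
      using m cSUP_upper[OF _ bdd, of ?M] by simp
    finally show ?thesis .
  qed
  then show thesis by (rule that)
qed

text \<open>The tail is small uniformly in \<open>x\<close>, and the head is a finite sum.\<close>

lemma eventually_weighted_square_sum_less:
  fixes c :: "int \<Rightarrow> complex" and \<delta> :: "'a \<Rightarrow> int \<Rightarrow> complex"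
  assumes B: "\<And>N::nat. (\<Sum>n\<in>{- int N..int N}. (cmod (c n))\<^sup>2) \<le> B"
    and \<delta>: "\<forall>\<^sub>F x in F. \<forall>n. cmod (\<delta> x n) \<le> K"
    and lim: "\<And>n. ((\<lambda>x. \<delta> x n) \<longlongrightarrow> 0) F"
    and "e > 0"
  shows "\<forall>\<^sub>F x in F. \<forall>N::nat. (\<Sum>n\<in>{- int N..int N}. (cmod (c n * \<delta> x n))\<^sup>2) < e"
proof -
  \<comment> \<open>The added 1 keeps the divisor positive even for \<open>K = 0\<close>.\<close>
  define k where "k = K\<^sup>2 + 1"
  define e' where "e' = e / (2 * k)"
  have k: "k > 0" by (simp add: k_def add_nonneg_pos)
  then have "e' > 0" using \<open>e > 0\<close> by (simp add: e'_def)
  obtain m :: nat where m: "\<And>N::nat. (\<Sum>n\<in>{- int N..int N} - {- int m..int m}. (cmod (c n))\<^sup>2) < e'"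
    using symmetric_square_sum_tail[OF B \<open>e' > 0\<close>] by blast
  let ?h = "\<lambda>x. \<Sum>n\<in>{- int m..int m}. (cmod (c n * \<delta> x n))\<^sup>2"
  have "(?h \<longlongrightarrow> (\<Sum>n\<in>{- int m..int m}. (cmod (c n * 0))\<^sup>2)) F"
    by (intro tendsto_intros lim)
  then have "(?h \<longlongrightarrow> 0) F" by simp
  then have "\<forall>\<^sub>F x in F. ?h x < e / 2"
    using \<open>e > 0\<close> by (intro order_tendstoD) auto
  with \<delta> show ?thesis
  proof (eventually_elim, intro allI)
    fix x and N :: nat
    assume \<delta>: "\<forall>n. cmod (\<delta> x n) \<le> K" and h: "?h x < e / 2"
    let ?T = "{- int N..int N} - {- int m..int m}"
    have "(\<Sum>n\<in>?T. (cmod (c n * \<delta> x n))\<^sup>2) \<le> (\<Sum>n\<in>?T. K\<^sup>2 * (cmod (c n))\<^sup>2)"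
      unfolding norm_mult power_mult_distrib mult.commute[of "K\<^sup>2"]
      using \<delta> by (intro sum_mono mult_left_mono power_mono) auto
    also have "\<dots> \<le> K\<^sup>2 * e'"
      unfolding sum_distrib_left[symmetric] using m[of N] by (intro mult_left_mono) auto
    also have "\<dots> \<le> k * e'"
      using \<open>e' > 0\<close> by (simp add: k_def distrib_right)
    also have "\<dots> = e / 2"
      using k by (simp add: e'_def)
    finally have T: "(\<Sum>n\<in>?T. (cmod (c n * \<delta> x n))\<^sup>2) \<le> e / 2" .
    have "(\<Sum>n\<in>{- int N..int N}. (cmod (c n * \<delta> x n))\<^sup>2)
        \<le> (\<Sum>n\<in>?T \<union> {- int m..int m}. (cmod (c n * \<delta> x n))\<^sup>2)"
      by (intro sum_mono2) auto
    also have "\<dots> = (\<Sum>n\<in>?T. (cmod (c n * \<delta> x n))\<^sup>2) + ?h x"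
      by (intro sum.union_disjoint) auto
    also have "\<dots> < e" using T h by simp
    finally show "(\<Sum>n\<in>{- int N..int N}. (cmod (c n * \<delta> x n))\<^sup>2) < e" .
  qed
qed

section \<open>L2 convergence to the paraxial solution\<close>

theorem theorem2:
  fixes d :: real and g :: "real \<Rightarrow> real"
  assumes "d > 0"
    and "\<And>x. g (- x) = g x"
    and "\<And>x. g (x + d) = g x"
    and "square_integrable_on g {0..d}"
  shows "\<forall>\<zeta>\<ge>0.
    ((\<lambda>\<epsilon>. LINT \<xi>:{0..1}|lebesgue. (cmod (U_eps d g \<epsilon> \<xi> \<zeta> - U_Par d g \<epsilon> \<xi> \<zeta>))\<^sup>2)
      \<longlongrightarrow> 0) (at_right 0)"
proof (intro allI impI)
  fix \<zeta> :: real assume \<zeta>: "\<zeta> \<ge> 0"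
  define c where "c n = complex_of_real (grating_coeff d g n)" for n
  define B where "B = 2 / d * (LINT x|lebesgue_on {0..d/2}. (g x)\<^sup>2)"
  have B: "(\<Sum>n\<in>{- int N..int N}. (cmod (c n))\<^sup>2) \<le> B" for N
    using grating_coeff_Bessel[OF assms(1,4)] by (simp add: c_def B_def)
  let ?I = "\<lambda>\<epsilon>. LINT \<xi>:{0..1}|lebesgue. (cmod (U_eps d g \<epsilon> \<xi> \<zeta> - U_Par d g \<epsilon> \<xi> \<zeta>))\<^sup>2"
  let ?\<delta> = "\<lambda>\<epsilon> n. helmholtz_factor \<epsilon> \<zeta> n - paraxial_factor \<epsilon> \<zeta> n"
  have pos: "\<forall>\<^sub>F \<epsilon> in at_right (0::real). 0 < \<epsilon>"
    by (rule eventually_at_right_less)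
  \<comment> \<open>The bound 2 adds the bounds 1 for the two factors; it is uniform in
    \<open>n\<close> and \<epsilon>.\<close>
  then have \<delta>: "\<forall>\<^sub>F \<epsilon> in at_right 0. \<forall>n. cmod (?\<delta> \<epsilon> n) \<le> 2"
  proof eventually_elim
    case (elim \<epsilon>)
    then show ?case
      using order_trans[OF norm_triangle_ineq4 add_mono[OF norm_helmholtz_factor_le[OF \<zeta> elim]
            eq_refl[OF norm_paraxial_factor]]]
      by auto
  qed
  have U: "has_L2_fourier_series (\<lambda>\<xi>. U_eps d g \<epsilon> \<xi> \<zeta>) (\<lambda>n. c n * helmholtz_factor \<epsilon> \<zeta> n)"
    if "\<epsilon> > 0" for \<epsilon>
  proof -
    have "(cmod (c n * helmholtz_factor \<epsilon> \<zeta> n))\<^sup>2 \<le> (cmod (c n))\<^sup>2" for n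
      unfolding norm_mult using norm_helmholtz_factor_le[OF \<zeta> that]
      by (intro power_mono mult_left_le) auto
    then have "(\<Sum>n\<in>{- int N..int N}. (cmod (c n * helmholtz_factor \<epsilon> \<zeta> n))\<^sup>2) \<le> B" for N
      using B[of N] by (meson order_trans sum_mono)
    from L2_fourier_sum_has_series[OF this] show ?thesis
      unfolding U_eps_def c_def .
  qed
  have V: "has_L2_fourier_series (\<lambda>\<xi>. U_Par d g \<epsilon> \<xi> \<zeta>) (\<lambda>n. c n * paraxial_factor \<epsilon> \<zeta> n)" for \<epsilon>
  proof -
    let ?p = "\<lambda>n. exp (\<i> * of_real pi * of_real \<zeta> * (of_int n)\<^sup>2)"
    have "cmod (?p n) = 1" for n
      using norm_exp_i_times[of "pi * \<zeta> * (real_of_int n)\<^sup>2"] by (simp add: mult_ac)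
    then have "(\<Sum>n\<in>{- int N..int N}. (cmod (c n * ?p n))\<^sup>2) \<le> B" for N
      using B[of N] by (simp add: norm_mult)
    from has_L2_fourier_series_cmult[OF L2_fourier_sum_has_series[OF this]]
    show ?thesis
      unfolding U_Par_def c_def paraxial_factor_def mult.left_commute[of "of_real (grating_coeff d g _)"] .
  qed
  show "(?I \<longlongrightarrow> 0) (at_right 0)"
  proof (rule tendstoI)
    fix e :: real assume "e > 0"
    \<comment> \<open>With the factor 4 of \<open>L2_distance_le_coeff_distance\<close> this yields
      the bound \<open>e / 2\<close>, strictly below \<open>e\<close>.\<close>
    then have "e / 8 > 0" by simp
    from eventually_weighted_square_sum_less[OF B \<delta> helmholtz_factor_paraxial_limit this] pos
    show "\<forall>\<^sub>F \<epsilon> in at_right 0. dist (?I \<epsilon>) 0 < e"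
    proof eventually_elim
      case (elim \<epsilon>)
      then have "(\<Sum>n\<in>{- int N..int N}.
          (cmod (c n * helmholtz_factor \<epsilon> \<zeta> n - c n * paraxial_factor \<epsilon> \<zeta> n))\<^sup>2) \<le> e / 8" for N
        by (simp only: right_diff_distrib[symmetric] less_imp_le)
      from L2_distance_le_coeff_distance[OF U[OF elim(2)] V this]
      have "?I \<epsilon> \<le> 4 * (e / 8)"
        by (simp only: set_lebesgue_integral_lebesgue_on lborelD sets_completionI_sets
            atLeastAtMost_borel sets_lborel)
      moreover have "?I \<epsilon> \<ge> 0"
        unfolding set_lebesgue_integral_def by (intro Bochner_Integration.integral_nonneg) auto
      ultimately show ?case using \<open>e > 0\<close> by (simp only: dist_real_def)
    qed
  qed
qed

end
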